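(* Let $n\ge 0$ be an integer and let $q,a,b$ be nonzero complex parameters such that no denominator occurring below vanishes. Then $$ {}_4\phi_3\left[\begin{array}{c} q^{-2n},\, a,\, b,\, q^{1-2n}/ab \\ q^{2-2n}/a,\, q^{2-2n}/b,\, abq\end{array};q^2,\,q^4\right] =\frac{(a,b,-q;q)_n\,(ab;q^2)_n}{(ab;q)_{n}\,(a,b;q^2)_n}. $$
   Context: For an integer $n\ge 0$, $(x;q)_n=\prod_{i=0}^{n-1}(1-xq^i)$ (so $(x;q)_0=1$), and $(x_1,\ldots,x_m;q)_n=\prod_{i=1}^m (x_i;q)_n$; $(x;q^2)_n$ is the same with $q$ replaced by $q^2$. The basic hypergeometric series is $${}_4\phi_3\left[\begin{array}{c} a_1,a_2,a_3,a_4\\ b_1,b_2,b_3\end{array};q,z\right]=\sum_{k\ge 0}\frac{(a_1,a_2,a_3,a_4;q)_k\,z^k}{(q,b_1,b_2,b_3;q)_k}.$$ In the claim the base is $q^2$ (replace $q$ by $q^2$ in the definition), the argument is $z=q^4$, and $a_1=q^{-2n}$, so the series terminates: it denotes the finite sum over $0\le k\le n$. Here $q^{c}/ab$ means $q^{c}/(ab)$. The identity is to be understood as an identity of rational functions in $a,b,q$, i.e. valid whenever no denominator vanishes. *)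

theory Defs
  imports Complex_Main
begin

definition qpoch :: "complex \<Rightarrow> complex \<Rightarrow> nat \<Rightarrow> complex" where
  "qpoch x q n = (\<Prod>i<n. 1 - x * q ^ i)"

definition qpochs :: "complex list \<Rightarrow> complex \<Rightarrow> nat \<Rightarrow> complex" where
  "qpochs xs q n = (\<Prod>x\<leftarrow>xs. qpoch x q n)"

definition phi43 ::
  "complex \<Rightarrow> complex \<Rightarrow> complex \<Rightarrow> complex \<Rightarrow> complex \<Rightarrow> complex \<Rightarrow> complex
    \<Rightarrow> complex \<Rightarrow> complex \<Rightarrow> complex" where
  "phi43 a1 a2 a3 a4 b1 b2 b3 q z =
     (\<Sum>k. qpochs [a1, a2, a3, a4] q k * z ^ k / qpochs [q, b1, b2, b3] q k)"

text \<open>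
  If \<open>a1\<close> is \<open>q powi (- n)\<close>, the numerators vanish for \<open>k > n\<close>. Since \<open>0 / x = 0\<close> for
  every \<open>x\<close>, the series is then the finite sum over \<open>k \<le> n\<close>, whatever the denominators
  are for \<open>k > n\<close>.
\<close>

lemma qpoch_powi_eq_0:
  assumes "q \<noteq> 0" "n < k"
  shows "qpoch (q powi (- int n)) q k = 0"
proof -
  have "1 - q powi (- int n) * q ^ n = 0"
    using assms(1) by (simp add: power_int_minus)
  thus ?thesis
    unfolding qpoch_def using assms(2) by (intro prod_zero) auto
qed

lemma phi43_terminating:
  assumes "q \<noteq> 0"
  shows "phi43 (q powi (- int n)) a2 a3 a4 b1 b2 b3 q z =
    (\<Sum>k\<le>n. qpochs [q powi (- int n), a2, a3, a4] q k * z ^ k / qpochs [q, b1, b2, b3] q k)"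
  unfolding phi43_def
  by (rule suminf_finite) (auto simp: qpochs_def qpoch_powi_eq_0[OF assms])

end

theory Submission
  imports Defs
begin

text \<open>
  Put \<open>p = q\<^sup>2\<close> and \<open>u\<^sub>k = (a, b; p)\<^sub>k / (p, abq; p)\<^sub>k\<close>. The parameters of the series pair off
  as \<open>x\<close> above and \<open>p\<^bsup>1-n\<^esup>/x\<close> below (for \<open>x = a, b\<close>) or the other way round (for \<open>x = p, abq\<close>).
  Reversing the order of the factors turns every \<open>(p\<^bsup>1-n\<^esup>/x; p)\<^sub>k\<close> into a quotient
  \<open>(x; p)\<^sub>n / (x; p)\<^bsub>n-k\<^esub>\<close>, up to monomials which combine to \<open>q\<^sup>k\<close>. The series is thus a constant
  multiple of the convolution \<open>T\<^sub>n = (\<Sum>k\<le>n. u\<^sub>k u\<^bsub>n-k\<^esub> q\<^sup>k)\<close>, the coefficient of \<open>z\<^sup>n\<close> in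
  \<open>F(z) F(qz)\<close>, where \<open>F\<close> is the series \<open>\<^sub>2\<phi>\<^sub>1(a, b; abq; p, z)\<close>. Its evaluation
  (\<open>q_clausen\<close>) is a \<open>q\<close>-analogue of Clausen's formula.

  The convolution has a closed form because it satisfies a recurrence of first order
  (\<open>conv_recurrence\<close>). Reflecting \<open>k\<close> to \<open>n - k\<close> shows that the weight \<open>q\<^sup>k\<close> may be
  replaced by the symmetric weight \<open>(q\<^sup>k + q\<^bsup>n-k\<^esup>)/2\<close>, and a symmetric weight by any weight with the
  same symmetrization. The polynomial identity \<open>kernel_identity\<close>, used with two different pairs
  \<open>s, t\<close>, provides weights for \<open>T\<^bsub>n+1\<^esub>\<close> and for \<open>T\<^sub>n\<close> that the recurrence of \<open>u\<close>
  carries into each other term by term.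
\<close>

section \<open>Finite \<open>q\<close>-shifted factorials\<close>

lemma qpoch_0 [simp]: "qpoch x q 0 = 1"
  by (simp add: qpoch_def)

lemma qpoch_Suc: "qpoch x q (Suc n) = qpoch x q n * (1 - x * q ^ n)"
  by (simp add: qpoch_def)

lemma qpoch_nonzero_mono:
  assumes "qpoch x q n \<noteq> 0" "m \<le> n"
  shows "qpoch x q m \<noteq> 0"
  using assms by (auto simp: qpoch_def)

lemma qpoch_square: "qpoch (x\<^sup>2) (q\<^sup>2) n = qpoch x q n * qpoch (- x) q n"
proof -
  have "1 - x\<^sup>2 * (q\<^sup>2) ^ i = (1 - x * q ^ i) * (1 - (- x) * q ^ i)" for i
    by (simp add: algebra_simps power2_eq_square power_mult_distrib)
  thus ?thesis
    by (simp add: qpoch_def prod.distrib)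
qed

text \<open>
  The last \<open>k\<close> factors of \<open>(x; p)\<^sub>n\<close> in reverse order, by
  \<open>1 - x p\<^bsup>n-1-i\<^esup> = - x p\<^bsup>n-1-i\<^esup> (1 - (p\<^bsup>1-n\<^esup>/x) p\<^sup>i)\<close>. The product of the powers of \<open>p\<close> does not
  depend on \<open>x\<close>, so it cancels when as many reversed factorials stand above as below.
\<close>
lemma qpoch_reverse:
  assumes "x \<noteq> 0" "p \<noteq> 0" "k \<le> n"
  shows "qpoch x p n =
    qpoch x p (n - k) * (- x) ^ k * (\<Prod>i<k. p ^ (n - 1 - i)) * qpoch (p powi (1 - int n) / x) p k"
  using \<open>k \<le> n\<close>
proof (induction k)
  case (Suc k)
  define m P where "m = n - Suc k" and "P = p powi (1 - int n) / x"
  have m: "n - k = Suc m" "n - 1 - k = m" "1 - int n = - int (k + m)"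
    using Suc.prems by (auto simp: m_def)
  have "p powi (1 - int n) * p ^ k * p ^ m = 1"
    using assms(2) unfolding m(3) power_int_minus power_int_of_nat by (simp add: power_add field_simps)
  hence factor: "1 - x * p ^ m = - x * p ^ m * (1 - P * p ^ k)"
    using assms by (simp add: P_def field_simps)
  have "qpoch x p n = qpoch x p (Suc m) * (- x) ^ k * (\<Prod>i<k. p ^ (n - 1 - i)) * qpoch P p k"
    using Suc.IH Suc.prems unfolding m(1) P_def by simp
  also have "\<dots> = qpoch x p m * (- x) ^ Suc k * (\<Prod>i<Suc k. p ^ (n - 1 - i)) * qpoch P p (Suc k)"
    unfolding qpoch_Suc factor prod.lessThan_Suc m(2) by simp
  finally show ?case
    by (simp only: m_def P_def)
qed simp

section \<open>A \<open>q\<close>-analogue of Clausen's formula\<close>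

definition clausen_coeff :: "complex \<Rightarrow> complex \<Rightarrow> complex \<Rightarrow> nat \<Rightarrow> complex" where
  "clausen_coeff a b q k =
     qpoch a (q\<^sup>2) k * qpoch b (q\<^sup>2) k / (qpoch (q\<^sup>2) (q\<^sup>2) k * qpoch (a * b * q) (q\<^sup>2) k)"

definition clausen_conv :: "complex \<Rightarrow> complex \<Rightarrow> complex \<Rightarrow> nat \<Rightarrow> complex" where
  "clausen_conv a b q n =
     (\<Sum>k\<le>n. clausen_coeff a b q k * clausen_coeff a b q (n - k) * q ^ k)"

lemma clausen_coeff_Suc:
  assumes "qpoch (q\<^sup>2) (q\<^sup>2) (Suc k) \<noteq> 0" "qpoch (a * b * q) (q\<^sup>2) (Suc k) \<noteq> 0"
  shows "(1 - (q\<^sup>2) ^ Suc k) * (1 - a * b * q * (q\<^sup>2) ^ k) * clausen_coeff a b q (Suc k) =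
         (1 - a * (q\<^sup>2) ^ k) * (1 - b * (q\<^sup>2) ^ k) * clausen_coeff a b q k"
  using assms by (simp add: clausen_coeff_def qpoch_Suc)

lemma sum_conv_symmetrize:
  fixes u :: "nat \<Rightarrow> complex"
  assumes "\<And>i j. i + j = n \<Longrightarrow> g i j + g j i = h i j + h j i"
  shows "(\<Sum>i\<le>n. u i * u (n - i) * g i (n - i)) = (\<Sum>i\<le>n. u i * u (n - i) * h i (n - i))"
proof -
  have double: "2 * (\<Sum>i\<le>n. u i * u (n - i) * f i (n - i)) =
      (\<Sum>i\<le>n. u i * u (n - i) * (f i (n - i) + f (n - i) i))" for f :: "nat \<Rightarrow> nat \<Rightarrow> complex"
  proof -
    have "(\<Sum>i\<le>n. u i * u (n - i) * f i (n - i)) = (\<Sum>i\<le>n. u (n - i) * u i * f (n - i) i)"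
      by (rule sum.reindex_bij_witness[of _ "\<lambda>i. n - i" "\<lambda>i. n - i"]) auto
    thus ?thesis
      by (simp add: sum.distrib ring_distribs mult_ac)
  qed
  have "2 * (\<Sum>i\<le>n. u i * u (n - i) * g i (n - i)) = 2 * (\<Sum>i\<le>n. u i * u (n - i) * h i (n - i))"
    unfolding double using assms by (intro sum.cong) auto
  thus ?thesis
    by simp
qed

text \<open>
  Symmetrizing the weight \<open>y\<close> alone would give terms \<open>s t (x\<^sup>4 y + x y\<^sup>4)\<close>. The correction
  \<open>- s t x y\<^sup>4\<close> cancels exactly these; every other term carries \<open>x + y\<close> times a power of \<open>x y\<close>.
  The coefficient of \<open>x + y\<close> thus depends on \<open>x y\<close> alone, which is constant along the
  convolution when \<open>x = q\<^sup>i\<close> and \<open>y = q\<^sup>j\<close>.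
\<close>
lemma kernel_identity:
  fixes x y s t :: complex
  shows "y * (1 - s * t * x * y ^ 3) * ((1 - s * x\<^sup>2) * (1 - t * x\<^sup>2)) +
         x * (1 - s * t * y * x ^ 3) * ((1 - s * y\<^sup>2) * (1 - t * y\<^sup>2)) =
         (1 - s * x * y) * (1 - t * x * y) * (1 - s * t * x\<^sup>2 * y\<^sup>2) * (x + y)"
  by algebra

text \<open>
  Both sides become the same sum: on the left \<open>kernel_identity\<close> with \<open>s = 1\<close>, \<open>t = ab/q\<close> produces
  the factor by which \<open>u\<^sub>i\<close> turns into \<open>u\<^bsub>i-1\<^esub>\<close>, and on the right its case \<open>s = a\<close>, \<open>t = b\<close>
  recombines the factor which that step leaves behind.
\<close>
lemma conv_recurrence:
  assumes "q \<noteq> 0"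
    and "qpoch (q\<^sup>2) (q\<^sup>2) (Suc n) \<noteq> 0" "qpoch (a * b * q) (q\<^sup>2) (Suc n) \<noteq> 0"
  shows "(1 - q ^ Suc n) * (1 - a * b * q ^ n) * (1 - a * b * q * (q\<^sup>2) ^ n)
           * clausen_conv a b q (Suc n) =
         (1 - a * q ^ n) * (1 - b * q ^ n) * (1 - a * b * (q\<^sup>2) ^ n) * clausen_conv a b q n"
    (is "?A * _ = ?B * _")
proof -
  let ?u = "clausen_coeff a b q"
  define w where "w j = q ^ j * (1 - a * b * q ^ n * (q\<^sup>2) ^ j)" for j
  define d where "d i = (1 - (q\<^sup>2) ^ i) * (1 - a * b / q * (q\<^sup>2) ^ i)" for i
  define e where "e i = (1 - a * (q\<^sup>2) ^ i) * (1 - b * (q\<^sup>2) ^ i)" for i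
  have sq: "(q\<^sup>2) ^ i = (q ^ i)\<^sup>2" for i
    by (simp flip: power_mult add: mult.commute)
  have step: "?u (Suc i) * d (Suc i) = ?u i * e i" if "i \<le> n" for i
  proof -
    have "qpoch (q\<^sup>2) (q\<^sup>2) (Suc i) \<noteq> 0" "qpoch (a * b * q) (q\<^sup>2) (Suc i) \<noteq> 0"
      using assms(2,3) that by (auto elim!: qpoch_nonzero_mono)
    from clausen_coeff_Suc[OF this] show ?thesis
      using assms(1) by (simp add: d_def e_def power2_eq_square mult_ac)
  qed
  have left: "w j * d i + w i * d j = ?A * q ^ i + ?A * q ^ j" if "i + j = Suc n" for i j
  proof -
    define x y where "x = q ^ i" and "y = q ^ j"
    have xy: "q ^ Suc n = x * y"
      using that by (simp add: x_def y_def flip: power_add)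
    hence qn: "q ^ n = x * y / q"
      using assms(1) by (simp add: field_simps)
    define t where "t = a * b / q"
    have ab: "a * b = t * q"
      using assms(1) by (simp add: t_def)
    have "w j = y * (1 - 1 * t * x * y ^ 3)" "w i = x * (1 - 1 * t * y * x ^ 3)"
      using assms(1)
      by (simp_all add: w_def sq qn ab flip: x_def y_def)
         (simp_all add: power2_eq_square power3_eq_cube mult_ac)
    moreover have "d i = (1 - 1 * x\<^sup>2) * (1 - t * x\<^sup>2)" "d j = (1 - 1 * y\<^sup>2) * (1 - t * y\<^sup>2)"
      by (simp_all add: d_def sq t_def x_def y_def)
    moreover have "?A = (1 - 1 * x * y) * (1 - t * x * y) * (1 - 1 * t * x\<^sup>2 * y\<^sup>2)"
      unfolding sq xy ab qn using assms(1) by (simp add: power2_eq_square mult_ac)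
    ultimately show ?thesis
      using kernel_identity[of y 1 t x] by (simp only: ring_distribs flip: x_def y_def)
  qed
  have right: "w j * e i + w i * e j = ?B * q ^ i + ?B * q ^ j" if "i + j = n" for i j
  proof -
    define x y where "x = q ^ i" and "y = q ^ j"
    have qn: "q ^ n = x * y"
      using that by (simp add: x_def y_def flip: power_add)
    have "w j = y * (1 - a * b * x * y ^ 3)" "w i = x * (1 - a * b * y * x ^ 3)"
      by (simp_all add: w_def sq qn flip: x_def y_def)
         (simp_all add: power2_eq_square power3_eq_cube mult_ac)
    moreover have "e i = (1 - a * x\<^sup>2) * (1 - b * x\<^sup>2)" "e j = (1 - a * y\<^sup>2) * (1 - b * y\<^sup>2)"
      by (simp_all add: e_def sq x_def y_def)
    moreover have "?B = (1 - a * x * y) * (1 - b * x * y) * (1 - a * b * x\<^sup>2 * y\<^sup>2)"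
      unfolding sq qn by (simp add: power2_eq_square mult_ac)
    ultimately show ?thesis
      using kernel_identity[of y a b x] by (simp only: ring_distribs flip: x_def y_def)
  qed
  have "?A * clausen_conv a b q (Suc n) = (\<Sum>i\<le>Suc n. ?u i * ?u (Suc n - i) * (?A * q ^ i))"
    unfolding clausen_conv_def sum_distrib_left by (intro sum.cong) (auto simp: mult_ac)
  also have "\<dots> = (\<Sum>i\<le>Suc n. ?u i * ?u (Suc n - i) * (w (Suc n - i) * d i))"
    using left by (intro sum_conv_symmetrize[of _ "\<lambda>i j. ?A * q ^ i" "\<lambda>i j. w j * d i"]) simp
  \<comment> \<open>The term \<open>i = 0\<close> drops out, since \<open>d 0 = 0\<close>.\<close>
  also have "\<dots> = (\<Sum>i\<le>n. ?u (Suc i) * ?u (n - i) * (w (n - i) * d (Suc i)))"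
    by (subst sum.atMost_Suc_shift) (simp add: d_def)
  also have "\<dots> = (\<Sum>i\<le>n. ?u i * ?u (n - i) * (w (n - i) * e i))"
  proof (intro sum.cong refl)
    fix i assume "i \<in> {..n}"
    hence "?u (Suc i) * d (Suc i) * (?u (n - i) * w (n - i)) = ?u i * e i * (?u (n - i) * w (n - i))"
      using step by simp
    thus "?u (Suc i) * ?u (n - i) * (w (n - i) * d (Suc i)) = ?u i * ?u (n - i) * (w (n - i) * e i)"
      by (simp only: mult_ac)
  qed
  also have "\<dots> = (\<Sum>i\<le>n. ?u i * ?u (n - i) * (?B * q ^ i))"
    using right by (intro sum_conv_symmetrize[of _ "\<lambda>i j. w j * e i" "\<lambda>i j. ?B * q ^ i"]) simp
  also have "\<dots> = ?B * clausen_conv a b q n"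
    unfolding clausen_conv_def sum_distrib_left by (intro sum.cong) (auto simp: mult_ac)
  finally show ?thesis .
qed

theorem q_clausen:
  assumes "q \<noteq> 0"
    and "qpoch (q\<^sup>2) (q\<^sup>2) n \<noteq> 0" "qpoch (a * b * q) (q\<^sup>2) n \<noteq> 0" "qpoch (a * b) q n \<noteq> 0"
  shows "clausen_conv a b q n = qpoch a q n * qpoch b q n * qpoch (a * b) (q\<^sup>2) n /
           (qpoch q q n * qpoch (a * b) q n * qpoch (a * b * q) (q\<^sup>2) n)"
  using assms(2-)
proof (induction n)
  case 0
  show ?case
    by (simp add: clausen_conv_def clausen_coeff_def)
next
  case (Suc n)
  have nz: "qpoch (q\<^sup>2) (q\<^sup>2) n \<noteq> 0" "qpoch (a * b * q) (q\<^sup>2) n \<noteq> 0" "qpoch (a * b) q n \<noteq> 0"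
    using Suc.prems by (auto elim!: qpoch_nonzero_mono)
  have "qpoch q q (Suc n) \<noteq> 0"
    using Suc.prems(1) by (simp add: qpoch_square)
  hence A: "qpoch q q n \<noteq> 0" "1 - q ^ Suc n \<noteq> 0" "1 - a * b * q ^ n \<noteq> 0"
      "1 - a * b * q * (q\<^sup>2) ^ n \<noteq> 0"
    using Suc.prems by (auto simp: qpoch_Suc)
  from A(2-) have "clausen_conv a b q (Suc n) =
      (1 - a * q ^ n) * (1 - b * q ^ n) * (1 - a * b * (q\<^sup>2) ^ n) * clausen_conv a b q n /
      ((1 - q ^ Suc n) * (1 - a * b * q ^ n) * (1 - a * b * q * (q\<^sup>2) ^ n))"
    using conv_recurrence[OF assms(1) Suc.prems(1,2)]
    by (subst eq_divide_eq) (simp del: power_Suc add: mult_ac)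
  thus ?case
    unfolding Suc.IH[OF nz] qpoch_Suc by (simp add: mult_ac)
qed

section \<open>From the series to the convolution\<close>

lemma phi43_term_eq_conv_term:
  assumes "q \<noteq> 0" "a \<noteq> 0" "b \<noteq> 0" "k \<le> n"
    and "qpoch (q\<^sup>2) (q\<^sup>2) n \<noteq> 0" "qpoch (a * b * q) (q\<^sup>2) n \<noteq> 0"
    and "qpoch a (q\<^sup>2) n \<noteq> 0" "qpoch b (q\<^sup>2) n \<noteq> 0"
  shows "qpochs [(q\<^sup>2) powi (- int n), a, b, (q\<^sup>2) powi (1 - int n) / (a * b * q)] (q\<^sup>2) k
           * (q ^ 4) ^ k /
         qpochs [q\<^sup>2, (q\<^sup>2) powi (1 - int n) / a, (q\<^sup>2) powi (1 - int n) / b, a * b * q] (q\<^sup>2) k =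
         qpoch (q\<^sup>2) (q\<^sup>2) n * qpoch (a * b * q) (q\<^sup>2) n / (qpoch a (q\<^sup>2) n * qpoch b (q\<^sup>2) n)
           * (clausen_coeff a b q k * clausen_coeff a b q (n - k) * q ^ k)"
proof -
  define p W where "p = q\<^sup>2" and "W = (\<Prod>i<k. p ^ (n - 1 - i))"
  define R where "R x = qpoch (p powi (1 - int n) / x) p k" for x
  have p: "p \<noteq> 0" and W: "W \<noteq> 0"
    using assms(1) by (auto simp: p_def W_def)
  have rev: "qpoch x p n = qpoch x p (n - k) * ((- x) ^ k * W * R x)" if "x \<noteq> 0" for x
    using qpoch_reverse[OF that p \<open>k \<le> n\<close>] by (simp add: W_def R_def mult_ac)
  have nz: "qpoch p p m \<noteq> 0" "qpoch (a * b * q) p m \<noteq> 0" "qpoch a p m \<noteq> 0" "qpoch b p m \<noteq> 0"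
    if "m \<le> n" for m
    using assms(5-) that by (auto simp: p_def elim!: qpoch_nonzero_mono)
  have Rnz: "R a \<noteq> 0" "R b \<noteq> 0"
    using rev[of a] rev[of b] nz(3,4)[of n] assms(2,3) by auto
  have "p powi (- int n) = p powi (1 - int n) / p"
    using p by (simp add: power_int_diff power_int_minus field_simps)
  hence first: "qpoch (p powi (- int n)) p k = R p"
    by (simp add: R_def)
  \<comment> \<open>The monomials left over by the four reversals and the argument \<open>p\<^sup>2\<close> of the series.\<close>
  have mono: "(q ^ 4) ^ k * ((- a) ^ k * (- b) ^ k) = (- p) ^ k * (- (a * b * q)) ^ k * q ^ k"
    by (simp add: p_def flip: power_mult_distrib)
       (simp add: power2_eq_square power4_eq_xxxx mult_ac)
  have "R p * qpoch a p k * qpoch b p k * R (a * b * q) * (q ^ 4) ^ k /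
      (qpoch p p k * R a * R b * qpoch (a * b * q) p k) =
      qpoch p p n * qpoch (a * b * q) p n / (qpoch a p n * qpoch b p n) *
      (qpoch a p k * qpoch b p k / (qpoch p p k * qpoch (a * b * q) p k) *
      (qpoch a p (n - k) * qpoch b p (n - k) / (qpoch p p (n - k) * qpoch (a * b * q) p (n - k)))
       * q ^ k)"
  proof -
    have c: "a * b * q \<noteq> 0"
      using assms(1-3) by simp
    have "(- a) ^ k \<noteq> 0" "(- b) ^ k \<noteq> 0"
      using assms(2,3) by auto
    moreover have "(q ^ 4) ^ k = (- p) ^ k * (- (a * b * q)) ^ k * q ^ k / ((- a) ^ k * (- b) ^ k)"
      using mono assms(2,3) by (simp add: eq_divide_eq)
    ultimately show ?thesis
      unfolding rev[OF p] rev[OF c] rev[OF assms(2)] rev[OF assms(3)]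
      using nz[of k] nz[of "n - k"] Rnz W \<open>k \<le> n\<close>
      by simp (simp add: mult_ac)
  qed
  thus ?thesis
    unfolding clausen_coeff_def qpochs_def p_def[symmetric]
    by (simp add: first mult_ac flip: R_def)
qed

theorem mainTheorem3:
  fixes q a b :: complex and n :: nat
  assumes "q \<noteq> 0" and "a \<noteq> 0" and "b \<noteq> 0"
    and "\<And>k. k \<le> n \<Longrightarrow>
      qpochs [q\<^sup>2, q powi (2 - 2 * int n) / a, q powi (2 - 2 * int n) / b, a * b * q] (q\<^sup>2) k \<noteq> 0"
    and "qpoch (a * b) q n * qpochs [a, b] (q\<^sup>2) n \<noteq> 0"
  shows "phi43 (q powi (- 2 * int n)) a b (q powi (1 - 2 * int n) / (a * b))
           (q powi (2 - 2 * int n) / a) (q powi (2 - 2 * int n) / b) (a * b * q)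
           (q\<^sup>2) (q ^ 4)
         = qpochs [a, b, - q] q n * qpoch (a * b) (q\<^sup>2) n
           / (qpoch (a * b) q n * qpochs [a, b] (q\<^sup>2) n)"
proof -
  have nz: "qpoch (q\<^sup>2) (q\<^sup>2) n \<noteq> 0" "qpoch (a * b * q) (q\<^sup>2) n \<noteq> 0" "qpoch (a * b) q n \<noteq> 0"
      "qpoch a (q\<^sup>2) n \<noteq> 0" "qpoch b (q\<^sup>2) n \<noteq> 0"
    using assms(4)[of n] assms(5) by (auto simp: qpochs_def)
  have q2: "q\<^sup>2 \<noteq> 0"
    using assms(1) by simp
  have base: "q powi (2 * m) = (q\<^sup>2) powi m" for m
    by (simp add: power_int_mult)
  have a1: "q powi (- 2 * int n) = (q\<^sup>2) powi (- int n)"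
    using base[of "- int n"] by simp
  have b12: "q powi (2 - 2 * int n) = (q\<^sup>2) powi (1 - int n)"
    using base[of "1 - int n"] by (simp add: algebra_simps)
  have "q powi (1 - 2 * int n) = q powi (2 - 2 * int n) / q"
    using assms(1) by (simp add: power_int_diff power2_eq_square)
  hence a4: "q powi (1 - 2 * int n) / (a * b) = (q\<^sup>2) powi (1 - int n) / (a * b * q)"
    unfolding b12 by (simp add: mult_ac)
  have "phi43 (q powi (- 2 * int n)) a b (q powi (1 - 2 * int n) / (a * b))
           (q powi (2 - 2 * int n) / a) (q powi (2 - 2 * int n) / b) (a * b * q) (q\<^sup>2) (q ^ 4)
      = qpoch (q\<^sup>2) (q\<^sup>2) n * qpoch (a * b * q) (q\<^sup>2) n / (qpoch a (q\<^sup>2) n * qpoch b (q\<^sup>2) n)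
        * clausen_conv a b q n"
    unfolding a1 a4 b12 clausen_conv_def sum_distrib_left phi43_terminating[OF q2]
    by (intro sum.cong refl phi43_term_eq_conv_term[OF assms(1-3) _ nz(1,2,4,5)]) simp
  thus ?thesis
    unfolding q_clausen[OF assms(1) nz(1-3)] using nz qpoch_square[of q q n]
    by (simp add: qpochs_def) (simp add: mult_ac)
qed

end
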